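(* Let $(M,g)$ be the Robinson–Trautman spacetime with coordinates $(t,r,x,y)$, constants $a,b,d\in\mathbb R$ and function $f=f(x,y)$, and let $F_1=f_x^2+f_y^2-f(f_{xx}+f_{yy})$. If $F_1-2a+4br\neq0$ and $rF_1-2ar+6d\neq0$ on $M$, then the spacetime possesses generalized Weyl conformal inheritance with respect to $\xi=\frac{\partial}{\partial x}$, namely $$\mathscr L_\xi C=\lambda_C C+\lambda_1\,g\wedge g+\lambda_2\,g\wedge S,$$ where $$\lambda_C=-\frac{F_5}{f(-6d+2ar-rF_1)},\qquad \lambda_2=\frac{2f_x(-6d+2ar-rF_1)}{3rf(F_1-2a+4br)},$$ $$\begin{aligned}\lambda_1=-\frac{1}{3r^3f(F_1-2a+4br)}\Big[&(-12ad+4a^2r+72bdr-24abr^2)f_x\\&+(6d-4ar+12br^2)(f_y^2f_x-ff_{yy}f_x+f_x^3-ff_xf_{xx})+rf_x(f_x^4+f_y^4)\\&-2rff_y^2f_x(f_{xx}+f_{yy})+rf^2f_x(f_{xx}+f_{yy})^2+2rf_x^3(f_y^2-ff_{xx}-ff_{yy})\Big],\end{aligned}$$ $$F_5=-12df_x+4arf_x-2rf_y^2f_x+rff_{yy}f_x-2rf_x^3+2rff_yf_{xy}-rf^2f_{xyy}+3rff_xf_{xx}-rf^2f_{xxx}.$$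
   Context: Robinson–Trautman (RT) spacetime: $a,b,d\in\mathbb R$ are constants; $M=I\times J\times\Omega$ with coordinates $(x^1,x^2,x^3,x^4)=(t,r,x,y)$, where $I\subset\mathbb R$ and $J\subset\mathbb R\setminus\{0\}$ are open intervals and $\Omega\subset\mathbb R^2$ is open, connected and nonempty; $f:\Omega\to\mathbb R$ is smooth and nowhere vanishing, with subscripts denoting partial derivatives; the metric is $$g=-2\Big(a-2br-\frac dr\Big)dt^2+2\,dt\,dr-\frac{r^2}{f^2}(dx^2+dy^2).$$ ($2\,dt\,dr$ means $g_{12}=g_{21}=1$.) Curvature conventions: with $\Gamma$ the Levi-Civita connection coefficients, $R_{pqrs}=g_{p\alpha}(\partial_r\Gamma^\alpha_{qs}-\partial_s\Gamma^\alpha_{qr}+\Gamma^\beta_{qs}\Gamma^\alpha_{\beta r}-\Gamma^\beta_{qr}\Gamma^\alpha_{\beta s})$, $S_{qr}=g^{ps}R_{pqrs}$ and $\kappa=g^{qr}S_{qr}$. With this convention $R_{1212}=-\frac{2d}{r^3}$, $S_{12}=-\frac{4b}{r}$, $S_{33}=S_{44}=\frac{F_1-2a+8br}{f^2}$, $\kappa=-\frac{2}{r^2}(F_1-2a+12br)$. The Kulkarni–Nomizu product of symmetric $(0,2)$ tensors is $(\phi\wedge\psi)_{pqrs}=\phi_{ps}\psi_{qr}-\phi_{pr}\psi_{qs}+\phi_{qr}\psi_{ps}-\phi_{qs}\psi_{pr}$. The Weyl conformal $(0,4)$ tensor (dimension 4) is $C=R-\frac12\,S\wedge g+\frac{\kappa}{6}G$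 with $G=\frac12\,g\wedge g$. Generalized Weyl conformal inheritance with respect to $\xi$ means $\mathscr L_\xi C=\lambda C+\lambda_1 g\wedge g+\lambda_2 g\wedge S$ for smooth functions $\lambda,\lambda_1,\lambda_2$, where $\mathscr L_\xi$ is the Lie derivative of the $(0,4)$ tensor. *)

theory Defs
  imports "HOL-Analysis.Analysis"
begin

section \<open>Partial derivatives and smoothness on open subsets of coordinate space\<close>

definition partial_deriv :: "'n::finite \<Rightarrow> (real^'n \<Rightarrow> real) \<Rightarrow> real^'n \<Rightarrow> real" where
  "partial_deriv i f p = deriv (\<lambda>h. f (p + h *\<^sub>R axis i 1)) 0"

text \<open>Both predicates below are intended for open sets \<open>U\<close> only.\<close>

primrec Ck_on :: "nat \<Rightarrow> (real^'n::finite \<Rightarrow> real) \<Rightarrow> (real^'n) set \<Rightarrow> bool" where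
  "Ck_on 0 f U \<longleftrightarrow> continuous_on U f"
| "Ck_on (Suc k) f U \<longleftrightarrow>
     (\<forall>p\<in>U. f differentiable (at p)) \<and> (\<forall>i. Ck_on k (partial_deriv i f) U)"

definition smooth_on :: "(real^'n::finite \<Rightarrow> real) \<Rightarrow> (real^'n) set \<Rightarrow> bool" where
  "smooth_on f U \<longleftrightarrow> (\<forall>k. Ck_on k f U)"

section \<open>Curvature of a metric given in coordinates\<close>

text \<open>Tensor fields are given by their components in a single global chart; a metric is a
  symmetric matrix field, and its inverse matrix supplies the components with raised indices.\<close>

type_synonym 'n metric = "real^'n \<Rightarrow> real^'n^'n"
type_synonym 'n tensor2 = "real^'n \<Rightarrow> 'n \<Rightarrow> 'n \<Rightarrow> real"
type_synonym 'n tensor4 = "real^'n \<Rightarrow> 'n \<Rightarrow> 'n \<Rightarrow> 'n \<Rightarrow> 'n \<Rightarrow> real"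

definition metric_tensor :: "'n::finite metric \<Rightarrow> 'n tensor2" where
  "metric_tensor g p i j = g p $ i $ j"

definition inverse_metric :: "'n::finite metric \<Rightarrow> 'n tensor2" where
  "inverse_metric g p i j = matrix_inv (g p) $ i $ j"

text \<open>\<open>christoffel g p k i j\<close> is \<open>\<Gamma>\<close> with upper index \<open>k\<close> and lower indices \<open>i j\<close>.\<close>

definition christoffel :: "'n::finite metric \<Rightarrow> real^'n \<Rightarrow> 'n \<Rightarrow> 'n \<Rightarrow> 'n \<Rightarrow> real" where
  "christoffel g p k i j = (1/2) * (\<Sum>l\<in>UNIV. inverse_metric g p k l *
      (partial_deriv i (\<lambda>z. metric_tensor g z l j) p
     + partial_deriv j (\<lambda>z. metric_tensor g z l i) p
     - partial_deriv l (\<lambda>z. metric_tensor g z i j) p))"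

definition riemann :: "'n::finite metric \<Rightarrow> 'n tensor4" where
  "riemann g z p q r s = (\<Sum>\<alpha>\<in>UNIV. metric_tensor g z p \<alpha> *
      (partial_deriv r (\<lambda>w. christoffel g w \<alpha> q s) z
     - partial_deriv s (\<lambda>w. christoffel g w \<alpha> q r) z
     + (\<Sum>\<beta>\<in>UNIV. christoffel g z \<beta> q s * christoffel g z \<alpha> \<beta> r)
     - (\<Sum>\<beta>\<in>UNIV. christoffel g z \<beta> q r * christoffel g z \<alpha> \<beta> s)))"

text \<open>The Ricci tensor contracts the first with the last index of the Riemann tensor.\<close>

definition ricci :: "'n::finite metric \<Rightarrow> 'n tensor2" where
  "ricci g z q r = (\<Sum>p\<in>UNIV. \<Sum>s\<in>UNIV. inverse_metric g z p s * riemann g z p q r s)"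

definition scalar_curvature :: "'n::finite metric \<Rightarrow> real^'n \<Rightarrow> real" where
  "scalar_curvature g z = (\<Sum>q\<in>UNIV. \<Sum>r\<in>UNIV. inverse_metric g z q r * ricci g z q r)"

definition kulkarni_nomizu :: "'n::finite tensor2 \<Rightarrow> 'n tensor2 \<Rightarrow> 'n tensor4" where
  "kulkarni_nomizu \<phi> \<psi> z p q r s =
     \<phi> z p s * \<psi> z q r - \<phi> z p r * \<psi> z q s + \<phi> z q r * \<psi> z p s - \<phi> z q s * \<psi> z p r"

text \<open>The coefficients \<open>1/2\<close> and \<open>1/6\<close> are those of dimension 4, hence the index type.\<close>

definition weyl :: "4 metric \<Rightarrow> 4 tensor4" where
  "weyl g z p q r s = riemann g z p q r s
     - (1/2) * kulkarni_nomizu (ricci g) (metric_tensor g) z p q r s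
     + (scalar_curvature g z / 6)
         * ((1/2) * kulkarni_nomizu (metric_tensor g) (metric_tensor g) z p q r s)"

definition lie_derivative4 :: "(real^'n::finite \<Rightarrow> real^'n) \<Rightarrow> 'n tensor4 \<Rightarrow> 'n tensor4" where
  "lie_derivative4 \<xi> T z p q r s = (\<Sum>m\<in>UNIV.
       \<xi> z $ m * partial_deriv m (\<lambda>w. T w p q r s) z
     + T z m q r s * partial_deriv p (\<lambda>w. \<xi> w $ m) z
     + T z p m r s * partial_deriv q (\<lambda>w. \<xi> w $ m) z
     + T z p q m s * partial_deriv r (\<lambda>w. \<xi> w $ m) z
     + T z p q r m * partial_deriv s (\<lambda>w. \<xi> w $ m) z)"

definition generalized_weyl_conformal_inheritance ::
  "(real^4) set \<Rightarrow> 4 metric \<Rightarrow> (real^4 \<Rightarrow> real^4)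
     \<Rightarrow> (real^4 \<Rightarrow> real) \<Rightarrow> (real^4 \<Rightarrow> real) \<Rightarrow> (real^4 \<Rightarrow> real) \<Rightarrow> bool" where
  "generalized_weyl_conformal_inheritance M g \<xi> \<mu> \<mu>\<^sub>1 \<mu>\<^sub>2 \<longleftrightarrow>
     smooth_on \<mu> M \<and> smooth_on \<mu>\<^sub>1 M \<and> smooth_on \<mu>\<^sub>2 M \<and>
     (\<forall>z\<in>M. \<forall>p q r s.
        lie_derivative4 \<xi> (weyl g) z p q r s =
          \<mu> z * weyl g z p q r s
        + \<mu>\<^sub>1 z * kulkarni_nomizu (metric_tensor g) (metric_tensor g) z p q r s
        + \<mu>\<^sub>2 z * kulkarni_nomizu (metric_tensor g) (ricci g) z p q r s)"

section \<open>The Robinson--Trautman spacetime\<close>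

text \<open>A point of the spacetime is \<open>z = (t, r, x, y)\<close>. The index type \<open>4\<close> has
  elements \<open>1, 2, 3, 4\<close> (where \<open>4 = 0\<close>); likewise for the index type \<open>2\<close> of
  the \<open>(x, y)\<close>-plane.\<close>

definition xy_part :: "real^4 \<Rightarrow> real^2" where
  "xy_part z = vector [z $ 3, z $ 4]"

definition rt_manifold :: "real set \<Rightarrow> real set \<Rightarrow> (real^2) set \<Rightarrow> (real^4) set" where
  "rt_manifold I J \<Omega> = {z. z $ 1 \<in> I \<and> z $ 2 \<in> J \<and> xy_part z \<in> \<Omega>}"

definition rt_metric :: "real \<Rightarrow> real \<Rightarrow> real \<Rightarrow> (real^2 \<Rightarrow> real) \<Rightarrow> 4 metric" where
  "rt_metric a b d f z = (let r = z $ 2 in \<chi> i j.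
     if i = 1 \<and> j = 1 then - 2 * (a - 2 * b * r - d / r)
     else if (i = 1 \<and> j = 2) \<or> (i = 2 \<and> j = 1) then 1
     else if (i = 3 \<and> j = 3) \<or> (i = 4 \<and> j = 4) then - (r\<^sup>2 / (f (xy_part z))\<^sup>2)
     else 0)"

definition coord_vector_x :: "real^4 \<Rightarrow> real^4" where
  "coord_vector_x z = axis 3 1"

definition F1 :: "(real^2 \<Rightarrow> real) \<Rightarrow> real^2 \<Rightarrow> real" where
  "F1 f u = (let fx = partial_deriv 1 f; fy = partial_deriv 2 f;
                 fxx = partial_deriv 1 fx; fyy = partial_deriv 2 fy
     in (fx u)\<^sup>2 + (fy u)\<^sup>2 - f u * (fxx u + fyy u))"

definition F5 :: "real \<Rightarrow> real \<Rightarrow> (real^2 \<Rightarrow> real) \<Rightarrow> real^4 \<Rightarrow> real" where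
  "F5 a d f z = (let u = xy_part z; r = z $ 2;
       fx = partial_deriv 1 f; fy = partial_deriv 2 f;
       fxx = partial_deriv 1 fx; fxy = partial_deriv 2 fx; fyy = partial_deriv 2 fy;
       fxxx = partial_deriv 1 fxx; fxyy = partial_deriv 2 fxy
     in - 12 * d * fx u + 4 * a * r * fx u - 2 * r * (fy u)\<^sup>2 * fx u
        + r * f u * fyy u * fx u - 2 * r * (fx u)^3 + 2 * r * f u * fy u * fxy u
        - r * (f u)\<^sup>2 * fxyy u + 3 * r * f u * fx u * fxx u - r * (f u)\<^sup>2 * fxxx u)"

definition lambda_C :: "real \<Rightarrow> real \<Rightarrow> (real^2 \<Rightarrow> real) \<Rightarrow> real^4 \<Rightarrow> real" where
  "lambda_C a d f z = (let u = xy_part z; r = z $ 2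
     in - (F5 a d f z / (f u * (- 6 * d + 2 * a * r - r * F1 f u))))"

definition lambda_1 :: "real \<Rightarrow> real \<Rightarrow> real \<Rightarrow> (real^2 \<Rightarrow> real) \<Rightarrow> real^4 \<Rightarrow> real" where
  "lambda_1 a b d f z = (let u = xy_part z; r = z $ 2; f0 = f u;
       fx = partial_deriv 1 f u; fy = partial_deriv 2 f u;
       fxx = partial_deriv 1 (partial_deriv 1 f) u;
       fyy = partial_deriv 2 (partial_deriv 2 f) u
     in - (1 / (3 * r^3 * f0 * (F1 f u - 2 * a + 4 * b * r))) *
        ((- 12 * a * d + 4 * a\<^sup>2 * r + 72 * b * d * r - 24 * a * b * r\<^sup>2) * fx
         + (6 * d - 4 * a * r + 12 * b * r\<^sup>2)
             * (fy\<^sup>2 * fx - f0 * fyy * fx + fx^3 - f0 * fx * fxx)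
         + r * fx * (fx^4 + fy^4)
         - 2 * r * f0 * fy\<^sup>2 * fx * (fxx + fyy)
         + r * f0\<^sup>2 * fx * (fxx + fyy)\<^sup>2
         + 2 * r * fx^3 * (fy\<^sup>2 - f0 * fxx - f0 * fyy)))"

definition lambda_2 :: "real \<Rightarrow> real \<Rightarrow> real \<Rightarrow> (real^2 \<Rightarrow> real) \<Rightarrow> real^4 \<Rightarrow> real" where
  "lambda_2 a b d f z = (let u = xy_part z; r = z $ 2
     in (2 * partial_deriv 1 f u * (- 6 * d + 2 * a * r - r * F1 f u))
        / (3 * r * f u * (F1 f u - 2 * a + 4 * b * r)))"

end

theory Submission
  imports Defs
begin

text \<open>
  Write \<open>r\<close> for the second coordinate. The metric is a block sum \<open>g = h + k\<close>: the part \<open>h\<close> lives on the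
  \<open>(t, r)\<close>-plane and does not see \<open>x, y\<close>, and \<open>k = - (r\<^sup>2 / f\<^sup>2) (dx\<^sup>2 + dy\<^sup>2)\<close> is a surface metric
  warped by \<open>r\<close>. Both blocks are two-dimensional and the Hessian of \<open>r\<close> in the first one is a multiple of
  \<open>h\<close>, so the curvature involves only three functions:
  \<open>R = (\<rho>\<^sub>1/2) h \<and> h + \<rho>\<^sub>2 h \<and> k + (\<rho>\<^sub>3/2) k \<and> k\<close>, which is \<open>riemann_rt\<close>. Tracing gives
  \<open>S = s\<^sub>1 h + s\<^sub>2 k\<close> with \<open>s\<^sub>1 = \<rho>\<^sub>1 + 2 \<rho>\<^sub>2\<close> and \<open>s\<^sub>2 = 2 \<rho>\<^sub>2 + \<rho>\<^sub>3\<close> (\<open>ricci_rt\<close>). Since the Weyl tensor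
  is trace-free, only one function \<open>w = (\<rho>\<^sub>1 - 2 \<rho>\<^sub>2 + \<rho>\<^sub>3)/3\<close> survives in it:
  \<open>C = w (h \<and> h - h \<and> k + k \<and> k)/2\<close> (\<open>weyl_two_block\<close>, \<open>weyl_rt\<close>).

  The field \<open>\<xi> = \<partial>\<^sub>x\<close> has constant components, so its Lie derivative just differentiates components in
  \<open>x\<close>. It annihilates \<open>h\<close> and multiplies \<open>k\<close> by \<open>\<mu> = - 2 f\<^sub>x / f\<close>. Hence both sides of the inheritance
  equation are combinations of \<open>h \<and> h\<close>, \<open>h \<and> k\<close> and \<open>k \<and> k\<close>, and comparing coefficients leaves three
  linear equations for the three unknown functions. They are solved by
  \<open>\<lambda>\<^sub>2 (s\<^sub>2 - s\<^sub>1) = w \<mu>\<close>, \<open>\<lambda>\<^sub>1 = - \<lambda>\<^sub>2 (s\<^sub>1 + s\<^sub>2)/2\<close> and \<open>\<lambda>\<^sub>C w = \<partial>\<^sub>x w + \<mu> w\<close>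
  (\<open>conformal_inheritance_two_block\<close>). Here \<open>s\<^sub>2 - s\<^sub>1 = - (F\<^sub>1 - 2 a + 4 b r)/r\<^sup>2\<close> and
  \<open>w = - (r F\<^sub>1 - 2 a r + 6 d)/(3 r\<^sup>3)\<close>, so the two nondegeneracy hypotheses say exactly that one may divide
  by these quantities; the given formulas are the resulting quotients, expanded
  (\<open>inheritance_coefficients\<close>).

  Two analytic points remain. The components \<open>R\<^sub>3\<^sub>3\<^sub>3\<^sub>4\<close> and \<open>R\<^sub>4\<^sub>4\<^sub>3\<^sub>4\<close> vanish, and \<open>\<partial>\<^sub>x F\<^sub>1\<close> agrees with the
  third-order terms of \<open>F\<^sub>5\<close>, only because mixed partial derivatives commute (\<open>partial_deriv_commute\<close>).
  And the coefficients are smooth because iterated continuous differentiability is stable under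
  arithmetic operations.
\<close>

section \<open>Partial derivatives and smooth functions\<close>


lemma eventually_line_mem:
  fixes p :: "real^'n"
  assumes "open U" "p \<in> U"
  shows "\<forall>\<^sub>F h in nhds (0::real). p + h *\<^sub>R v \<in> U"
proof -
  have "((\<lambda>h::real. p + h *\<^sub>R v) \<longlongrightarrow> p + 0 *\<^sub>R v) (nhds 0)"
    by (intro tendsto_intros filterlim_ident)
  then show ?thesis
    using assms by (auto dest: topological_tendstoD)
qed

text \<open>A partial derivative depends only on the germ of the function. This is what allows formulas for metric,
  Christoffel symbols and curvature that hold only on the manifold to be differentiated there.\<close>

lemma partial_deriv_cong_open:
  assumes "open U" "p \<in> U" "\<And>q. q \<in> U \<Longrightarrow> f q = g q"
  shows "partial_deriv i f p = partial_deriv i g p"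
  unfolding partial_deriv_def
  by (rule deriv_cong_ev[OF eventually_mono[OF eventually_line_mem[OF assms(1,2), of "axis i 1"]]])
     (auto simp: assms(3))

text \<open>The derivative is taken at an arbitrary point \<open>s\<close> of the coordinate line, as the mean value theorem
  requires further below.\<close>

lemma has_real_derivative_along_axis:
  assumes "f differentiable (at (p + s *\<^sub>R axis i 1))"
  shows "((\<lambda>h. f (p + h *\<^sub>R axis i 1)) has_real_derivative partial_deriv i f (p + s *\<^sub>R axis i 1)) (at s)"
proof -
  have "(\<lambda>h. f (p + h *\<^sub>R axis i 1)) differentiable (at s)"
    by (rule differentiable_compose[where f = f]) (use assms in \<open>auto intro!: derivative_intros\<close>)
  then obtain D where D: "((\<lambda>h. f (p + h *\<^sub>R axis i 1)) has_real_derivative D) (at s)"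
    using real_differentiable_def by blast
  then have "((\<lambda>h. f (p + s *\<^sub>R axis i 1 + h *\<^sub>R axis i 1)) has_real_derivative D) (at 0)"
    using DERIV_shift[of "\<lambda>h. f (p + h *\<^sub>R axis i 1)" D 0 s] by (simp add: algebra_simps)
  then have "partial_deriv i f (p + s *\<^sub>R axis i 1) = D"
    unfolding partial_deriv_def by (rule DERIV_imp_deriv)
  with D show ?thesis by simp
qed

lemma has_real_derivative_partial_deriv:
  assumes "f differentiable (at p)"
  shows "((\<lambda>h. f (p + h *\<^sub>R axis i 1)) has_real_derivative partial_deriv i f p) (at 0)"
  using has_real_derivative_along_axis[of f p 0 i] assms by simp

lemma partial_deriv_const [simp]: "partial_deriv i (\<lambda>q. c) p = 0"
  by (simp add: partial_deriv_def)

lemma partial_deriv_add: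
  assumes "f differentiable (at p)" "g differentiable (at p)"
  shows "partial_deriv i (\<lambda>q. f q + g q) p = partial_deriv i f p + partial_deriv i g p"
  unfolding partial_deriv_def[of i "\<lambda>q. f q + g q"]
  by (rule DERIV_imp_deriv) (auto intro!: derivative_eq_intros has_real_derivative_partial_deriv assms)

lemma partial_deriv_minus:
  assumes "f differentiable (at p)"
  shows "partial_deriv i (\<lambda>q. - f q) p = - partial_deriv i f p"
  unfolding partial_deriv_def[of i "\<lambda>q. - f q"]
  by (rule DERIV_imp_deriv) (auto intro!: derivative_eq_intros has_real_derivative_partial_deriv assms)

lemma partial_deriv_mult:
  assumes "f differentiable (at p)" "g differentiable (at p)"
  shows "partial_deriv i (\<lambda>q. f q * g q) p = partial_deriv i f p * g p + f p * partial_deriv i g p"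
  unfolding partial_deriv_def[of i "\<lambda>q. f q * g q"]
  by (rule DERIV_imp_deriv)
     (rule derivative_eq_intros has_real_derivative_partial_deriv assms refl | simp add: algebra_simps)+

lemma partial_deriv_inverse:
  assumes "f differentiable (at p)" "f p \<noteq> 0"
  shows "partial_deriv i (\<lambda>q. inverse (f q)) p = - partial_deriv i f p * (inverse (f p) * inverse (f p))"
  unfolding partial_deriv_def[of i "\<lambda>q. inverse (f q)"]
  by (rule DERIV_imp_deriv)
     (rule derivative_eq_intros has_real_derivative_partial_deriv assms refl | simp add: algebra_simps power2_eq_square assms(2))+

text \<open>The rules for sums, products and inverses are inductions on the order: each partial derivative of the
  compound function agrees on \<open>U\<close> with an expression that has one derivative to spare. Agreement holds only
  on \<open>U\<close>, so the inductions rest on this congruence.\<close>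

lemma Ck_on_cong:
  assumes "open U" "\<And>q. q \<in> U \<Longrightarrow> f q = g q"
  shows "Ck_on k f U \<longleftrightarrow> Ck_on k g U"
proof -
  have *: "Ck_on k g U" if "Ck_on k f U" "\<And>q. q \<in> U \<Longrightarrow> f q = g q" for f g
    using that
  proof (induction k arbitrary: f g)
    case 0
    then show ?case by (simp cong: continuous_on_cong)
  next
    case (Suc k)
    have "g differentiable (at p)" if "p \<in> U" for p
      using Suc.prems that assms(1) unfolding differentiable_def Ck_on.simps
      by (meson has_derivative_transform_within_open)
    moreover have "Ck_on k (partial_deriv i g) U" for i
    proof (rule Suc.IH[of "partial_deriv i f"])
      show "Ck_on k (partial_deriv i f) U" using Suc.prems(1) by simp
      show "partial_deriv i f q = partial_deriv i g q" if "q \<in> U" for q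
        by (rule partial_deriv_cong_open[OF assms(1) that Suc.prems(2)])
    qed
    ultimately show ?case by simp
  qed
  show ?thesis using *[of f g] *[of g f] assms(2) by auto
qed

lemma Ck_on_imp_continuous_on: "Ck_on k f U \<Longrightarrow> continuous_on U f"
  by (cases k) (auto intro!: differentiable_imp_continuous_on differentiable_at_imp_differentiable_on)

lemma Ck_on_SucD: "Ck_on (Suc k) f U \<Longrightarrow> Ck_on k f U"
proof (induction k arbitrary: f)
  case 0
  then show ?case using Ck_on_imp_continuous_on[of "Suc 0"] by simp
next
  case (Suc k)
  then show ?case by (simp only: Ck_on.simps) blast
qed

lemma Ck_on_const: "Ck_on k (\<lambda>q. c) U"
proof (induction k arbitrary: c)
  case (Suc k)
  have "partial_deriv i (\<lambda>q. c) = (\<lambda>q. 0)" for i :: 'a by auto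
  then show ?case using Suc by simp
qed simp

lemma Ck_on_add:
  assumes "open U" "Ck_on k f U" "Ck_on k g U"
  shows "Ck_on k (\<lambda>q. f q + g q) U"
  using assms(2,3)
proof (induction k arbitrary: f g)
  case 0
  then show ?case by (simp add: continuous_on_add)
next
  case (Suc k)
  have "Ck_on k (partial_deriv i (\<lambda>q. f q + g q)) U" for i
  proof (rule Ck_on_cong[THEN iffD2, OF assms(1)])
    show "partial_deriv i (\<lambda>q. f q + g q) q = partial_deriv i f q + partial_deriv i g q" if "q \<in> U" for q
      using Suc.prems that by (intro partial_deriv_add) auto
    show "Ck_on k (\<lambda>q. partial_deriv i f q + partial_deriv i g q) U"
      using Suc.prems by (intro Suc.IH) auto
  qed
  with Suc.prems show ?case by auto
qed

lemma Ck_on_mult: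
  assumes "open U" "Ck_on k f U" "Ck_on k g U"
  shows "Ck_on k (\<lambda>q. f q * g q) U"
  using assms(2,3)
proof (induction k arbitrary: f g)
  case 0
  then show ?case by (simp add: continuous_on_mult)
next
  case (Suc k)
  note low = Suc.prems[THEN Ck_on_SucD]
  have "Ck_on k (partial_deriv i (\<lambda>q. f q * g q)) U" for i
  proof (rule Ck_on_cong[THEN iffD2, OF assms(1)])
    show "partial_deriv i (\<lambda>q. f q * g q) q = partial_deriv i f q * g q + f q * partial_deriv i g q"
      if "q \<in> U" for q
      using Suc.prems that by (intro partial_deriv_mult) auto
    show "Ck_on k (\<lambda>q. partial_deriv i f q * g q + f q * partial_deriv i g q) U"
      using Suc.prems by (intro Ck_on_add[OF assms(1)] Suc.IH low) auto
  qed
  with Suc.prems show ?case by auto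
qed

lemma Ck_on_inverse:
  assumes "open U" "Ck_on k f U" "\<And>q. q \<in> U \<Longrightarrow> f q \<noteq> 0"
  shows "Ck_on k (\<lambda>q. inverse (f q)) U"
  using assms(2)
proof (induction k)
  case 0
  then show ?case using assms(3) by (auto intro!: continuous_intros)
next
  case (Suc k)
  have inv: "Ck_on k (\<lambda>q. inverse (f q)) U"
    using Suc.IH Suc.prems Ck_on_SucD by blast
  have "Ck_on k (partial_deriv i (\<lambda>q. inverse (f q))) U" for i
  proof (rule Ck_on_cong[THEN iffD2, OF assms(1)])
    show "partial_deriv i (\<lambda>q. inverse (f q)) q
        = - 1 * partial_deriv i f q * (inverse (f q) * inverse (f q))" if "q \<in> U" for q
      using Suc.prems assms(3) that by (subst partial_deriv_inverse) auto
    show "Ck_on k (\<lambda>q. - 1 * partial_deriv i f q * (inverse (f q) * inverse (f q))) U"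
      using Suc.prems by (intro Ck_on_mult assms(1) Ck_on_const inv) auto
  qed
  moreover have "(\<lambda>q. inverse (f q)) differentiable (at p)" if "p \<in> U" for p
    by (rule differentiable_inverse) (use Suc.prems assms(3) that in simp_all)
  ultimately show ?case unfolding Ck_on.simps by blast
qed

lemma smooth_on_differentiable: "smooth_on f U \<Longrightarrow> p \<in> U \<Longrightarrow> f differentiable (at p)"
  unfolding smooth_on_def by (metis Ck_on.simps(2))

lemma smooth_on_partial_deriv: "smooth_on f U \<Longrightarrow> smooth_on (partial_deriv i f) U"
  unfolding smooth_on_def by (metis Ck_on.simps(2))

lemma smooth_on_const: "smooth_on (\<lambda>q. c) U"
  by (simp add: smooth_on_def Ck_on_const)

lemma smooth_on_add: "open U \<Longrightarrow> smooth_on f U \<Longrightarrow> smooth_on g U \<Longrightarrow> smooth_on (\<lambda>q. f q + g q) U"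
  by (simp add: smooth_on_def Ck_on_add)

lemma smooth_on_mult: "open U \<Longrightarrow> smooth_on f U \<Longrightarrow> smooth_on g U \<Longrightarrow> smooth_on (\<lambda>q. f q * g q) U"
  by (simp add: smooth_on_def Ck_on_mult)

lemma smooth_on_minus: "open U \<Longrightarrow> smooth_on f U \<Longrightarrow> smooth_on (\<lambda>q. - f q) U"
  using smooth_on_mult[OF _ smooth_on_const[of "-1"], of U f] by simp

lemma smooth_on_diff: "open U \<Longrightarrow> smooth_on f U \<Longrightarrow> smooth_on g U \<Longrightarrow> smooth_on (\<lambda>q. f q - g q) U"
  using smooth_on_add[OF _ _ smooth_on_minus, of U f g] by simp

lemma smooth_on_power: "open U \<Longrightarrow> smooth_on f U \<Longrightarrow> smooth_on (\<lambda>q. f q ^ n) U"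
  by (induction n) (auto intro: smooth_on_const smooth_on_mult)

lemma smooth_on_divide:
  "open U \<Longrightarrow> smooth_on f U \<Longrightarrow> smooth_on g U \<Longrightarrow> (\<And>q. q \<in> U \<Longrightarrow> g q \<noteq> 0) \<Longrightarrow> smooth_on (\<lambda>q. f q / g q) U"
  unfolding divide_inverse
  by (rule smooth_on_mult) (auto simp: smooth_on_def Ck_on_inverse)

text \<open>The components of the tensors are selected by index conditions that do not depend on the point.\<close>

lemma smooth_on_if:
  "(P \<Longrightarrow> smooth_on F U) \<Longrightarrow> (\<not> P \<Longrightarrow> smooth_on G U) \<Longrightarrow> smooth_on (\<lambda>q. if P then F q else G q) U"
  by (cases P) simp_all

lemma partial_deriv_nth: "partial_deriv i (\<lambda>q. q $ j) p = (if i = j then 1 else 0)"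
  unfolding partial_deriv_def
  by (rule DERIV_imp_deriv) (auto intro!: derivative_eq_intros simp: axis_def)

lemma smooth_on_nth: "smooth_on (\<lambda>q. q $ j) U"
  unfolding smooth_on_def
proof
  fix k show "Ck_on k (\<lambda>q. q $ j) U"
  proof (cases k)
    case 0
    then show ?thesis by (auto intro!: continuous_intros)
  next
    case (Suc m)
    have "partial_deriv i (\<lambda>q. q $ j) = (\<lambda>q. if i = j then 1 else 0)" for i :: 'a
      by (rule ext) (rule partial_deriv_nth)
    then show ?thesis
      by (auto simp: Suc intro!: Ck_on_const bounded_linear_imp_differentiable bounded_linear_vec_nth)
  qed
qed

section \<open>Symmetry of second partial derivatives\<close>

text \<open>The second difference over a small square is symmetric in the two directions, while two applications
  of the mean value theorem, first in direction \<open>i\<close> and then in direction \<open>j\<close>, express it by one of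
  the two mixed derivatives at a nearby point.\<close>

lemma second_difference_mean_value:
  fixes f :: "real^'n \<Rightarrow> real"
  assumes C2: "Ck_on 2 f U" and ball: "ball p e \<subseteq> U" and h: "0 < h" "2 * h < e"
  shows "\<exists>q. dist p q < 2 * h \<and>
    f (p + h *\<^sub>R axis i 1 + h *\<^sub>R axis j 1) - f (p + h *\<^sub>R axis i 1) - f (p + h *\<^sub>R axis j 1) + f p
      = h\<^sup>2 * partial_deriv j (partial_deriv i f) q"
proof -
  have near: "dist p (p + s *\<^sub>R axis i 1 + t *\<^sub>R axis j 1) \<le> s + t" if "0 \<le> s" "0 \<le> t" for s t
  proof -
    have "dist p (p + s *\<^sub>R axis i 1 + t *\<^sub>R axis j 1) = norm (s *\<^sub>R axis i (1::real) + t *\<^sub>R axis j 1)"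
      by (subst dist_commute) (simp add: dist_norm add.assoc)
    also have "\<dots> \<le> norm (s *\<^sub>R axis i (1::real)) + norm (t *\<^sub>R axis j (1::real))"
      by (rule norm_triangle_ineq)
    finally show ?thesis using that by simp
  qed
  have mem: "p + s *\<^sub>R axis i 1 + t *\<^sub>R axis j 1 \<in> U" if "0 \<le> s" "0 \<le> t" "s \<le> h" "t \<le> h" for s t
    using near[OF that(1,2)] that h ball by (force simp: mem_ball)
  have d1: "f differentiable (at q)" if "q \<in> U" for q
    using C2 that by (simp add: numeral_2_eq_2)
  have d2: "partial_deriv i f differentiable (at q)" if "q \<in> U" for q
    using C2 that by (simp add: numeral_2_eq_2)
  \<comment> \<open>The increment of \<open>\<phi>\<close> over \<open>[0, h]\<close> is the second difference.\<close>
  define \<phi> where "\<phi> s = f ((p + h *\<^sub>R axis j 1) + s *\<^sub>R axis i 1) - f (p + s *\<^sub>R axis i 1)" for s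
  have "(\<phi> has_real_derivative
      partial_deriv i f ((p + h *\<^sub>R axis j 1) + s *\<^sub>R axis i 1) - partial_deriv i f (p + s *\<^sub>R axis i 1)) (at s)"
    if "0 \<le> s" "s \<le> h" for s
    unfolding \<phi>_def
    using mem[OF that(1) less_imp_le[OF h(1)] that(2)] mem[OF that(1) _ that(2), of 0] h
    by (intro DERIV_diff has_real_derivative_along_axis d1) (auto simp: algebra_simps)
  from MVT2[OF h(1), of \<phi>, OF this] obtain s where s: "0 < s" "s < h"
    and \<phi>: "\<phi> h - \<phi> 0 = h * (partial_deriv i f ((p + h *\<^sub>R axis j 1) + s *\<^sub>R axis i 1)
                        - partial_deriv i f (p + s *\<^sub>R axis i 1))"
    by auto
  define \<psi> where "\<psi> t = partial_deriv i f ((p + s *\<^sub>R axis i 1) + t *\<^sub>R axis j 1)" for t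
  have "(\<psi> has_real_derivative partial_deriv j (partial_deriv i f) ((p + s *\<^sub>R axis i 1) + t *\<^sub>R axis j 1)) (at t)"
    if "0 \<le> t" "t \<le> h" for t
    unfolding \<psi>_def using mem[of s t] s that
    by (intro has_real_derivative_along_axis d2) auto
  from MVT2[OF h(1), of \<psi>, OF this] obtain t where t: "0 < t" "t < h"
    and \<psi>: "\<psi> h - \<psi> 0 = h * partial_deriv j (partial_deriv i f) ((p + s *\<^sub>R axis i 1) + t *\<^sub>R axis j 1)"
    by auto
  have "dist p (p + s *\<^sub>R axis i 1 + t *\<^sub>R axis j 1) < 2 * h"
    using near[of s t] s t by linarith
  moreover have "f (p + h *\<^sub>R axis i 1 + h *\<^sub>R axis j 1) - f (p + h *\<^sub>R axis i 1) - f (p + h *\<^sub>R axis j 1) + f p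
      = \<phi> h - \<phi> 0"
    by (simp add: \<phi>_def algebra_simps)
  moreover have "\<phi> h - \<phi> 0 = h * (\<psi> h - \<psi> 0)"
    unfolding \<phi> \<psi>_def by (simp add: algebra_simps)
  ultimately show ?thesis
    unfolding \<psi> power2_eq_square mult.assoc by metis
qed

text \<open>Exchanging \<open>i\<close> and \<open>j\<close> in the second difference shows that the two mixed derivatives take equal
  values at points arbitrarily close to \<open>p\<close>; by continuity they agree at \<open>p\<close>.\<close>

lemma partial_deriv_commute:
  fixes f :: "real^'n \<Rightarrow> real"
  assumes "open U" "p \<in> U" "Ck_on 2 f U"
  shows "partial_deriv i (partial_deriv j f) p = partial_deriv j (partial_deriv i f) p"
proof (rule ccontr)
  define A where "A = partial_deriv j (partial_deriv i f)"
  define B where "B = partial_deriv i (partial_deriv j f)"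
  assume "\<not> ?thesis"
  then have neq: "A p \<noteq> B p" by (simp add: A_def B_def)
  have cont: "continuous (at p) A" "continuous (at p) B"
    using assms(3) by (auto simp: A_def B_def numeral_2_eq_2 continuous_on_eq_continuous_at[OF assms(1)] assms(2))
  define \<epsilon> where "\<epsilon> = \<bar>A p - B p\<bar> / 2"
  have "\<epsilon> > 0" using neq by (simp add: \<epsilon>_def)
  obtain e where e: "e > 0" "ball p e \<subseteq> U"
    using assms(1,2) by (rule openE)
  obtain d1 where d1: "d1 > 0" "\<And>q. dist q p < d1 \<Longrightarrow> dist (A q) (A p) < \<epsilon>"
    using cont(1) \<open>\<epsilon> > 0\<close> unfolding continuous_at_eps_delta by metis
  obtain d2 where d2: "d2 > 0" "\<And>q. dist q p < d2 \<Longrightarrow> dist (B q) (B p) < \<epsilon>"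
    using cont(2) \<open>\<epsilon> > 0\<close> unfolding continuous_at_eps_delta by metis
  \<comment> \<open>Both intermediate points lie within \<open>2 h\<close> of \<open>p\<close>, which must stay below each of the three radii.\<close>
  define h where "h = min e (min d1 d2) / 4"
  have h: "0 < h" "2 * h < e" "2 * h < d1" "2 * h < d2"
    using e d1 d2 by (auto simp: h_def min_def)
  obtain q where q: "dist p q < 2 * h"
    "f (p + h *\<^sub>R axis i 1 + h *\<^sub>R axis j 1) - f (p + h *\<^sub>R axis i 1) - f (p + h *\<^sub>R axis j 1) + f p = h\<^sup>2 * A q"
    using second_difference_mean_value[OF assms(3) e(2) h(1,2), of i j] unfolding A_def by blast
  obtain q' where q': "dist p q' < 2 * h"
    "f (p + h *\<^sub>R axis j 1 + h *\<^sub>R axis i 1) - f (p + h *\<^sub>R axis j 1) - f (p + h *\<^sub>R axis i 1) + f p = h\<^sup>2 * B q'"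
    using second_difference_mean_value[OF assms(3) e(2) h(1,2), of j i] unfolding B_def by blast
  have "h\<^sup>2 * A q = h\<^sup>2 * B q'"
    using q(2) q'(2) by (simp add: algebra_simps)
  then have "A q = B q'" using h(1) by simp
  moreover have "dist (A q) (A p) < \<epsilon>" "dist (B q') (B p) < \<epsilon>"
    using d1(2)[of q] d2(2)[of q'] q(1) q'(1) h by (auto simp: dist_commute)
  ultimately show False
    using \<open>\<epsilon> > 0\<close> unfolding \<epsilon>_def dist_real_def by (auto simp: abs_if split: if_splits)
qed

lemma smooth_on_partial_deriv_commute:
  assumes "open U" "smooth_on f U" "p \<in> U"
  shows "partial_deriv i (partial_deriv j f) p = partial_deriv j (partial_deriv i f) p"
  using assms partial_deriv_commute unfolding smooth_on_def by blast


section \<open>Tensor algebra of a metric that splits into two blocks\<close>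

lemma matrix_inv_eqI:
  fixes A B :: "real^'n::finite^'n"
  assumes "A ** B = mat 1" "B ** A = mat 1"
  shows "matrix_inv A = B"
  unfolding matrix_inv_def
proof (rule some_equality)
  fix B' assume "A ** B' = mat 1 \<and> B' ** A = mat 1"
  then show "B' = B"
    by (metis assms(1) matrix_mul_assoc matrix_mul_lid matrix_mul_rid)
qed (use assms in simp)

text \<open>Skew-symmetry in the last two indices is visible in the defining formula for any metric and leaves
  only six index pairs to compute.\<close>

lemma riemann_skew_last: "riemann g z p q s r = - riemann g z p q r s"
  unfolding riemann_def sum_negf[symmetric]
  by (rule sum.cong) (simp_all add: algebra_simps)

lemma kulkarni_nomizu_skew_last:
  "kulkarni_nomizu \<phi> \<psi> z p q s r = - kulkarni_nomizu \<phi> \<psi> z p q r s"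
  by (simp add: kulkarni_nomizu_def)

text \<open>Up to a factor this is the only combination of \<open>h \<and> h\<close>, \<open>h \<and> k\<close> and \<open>k \<and> k\<close> that is trace-free with
  respect to \<open>h + k\<close> when both blocks have rank two.\<close>

definition block_weyl :: "'n::finite tensor2 \<Rightarrow> 'n tensor2 \<Rightarrow> 'n tensor4" where
  "block_weyl h k z p q r s = (1/2) * kulkarni_nomizu h h z p q r s
     - (1/2) * kulkarni_nomizu h k z p q r s + (1/2) * kulkarni_nomizu k k z p q r s"

text \<open>Once the curvature quantities are expressed in the two blocks, the
  defining formula of the Weyl tensor is bilinear in them and only coefficients have to be compared.
  The coefficient of \<open>(1/2) h \<and> h\<close>, for instance, is \<open>\<rho>\<^sub>1 - s\<^sub>1 + \<kappa>/6\<close>.\<close>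

lemma weyl_two_block:
  assumes g: "\<And>i j. metric_tensor g z i j = h z i j + k z i j"
    and R: "\<And>p q r s. riemann g z p q r s = \<rho>\<^sub>1 / 2 * kulkarni_nomizu h h z p q r s
          + \<rho>\<^sub>2 * kulkarni_nomizu h k z p q r s + \<rho>\<^sub>3 / 2 * kulkarni_nomizu k k z p q r s"
    and S: "\<And>i j. ricci g z i j = (\<rho>\<^sub>1 + 2 * \<rho>\<^sub>2) * h z i j + (2 * \<rho>\<^sub>2 + \<rho>\<^sub>3) * k z i j"
    and \<kappa>: "scalar_curvature g z = 2 * (\<rho>\<^sub>1 + 2 * \<rho>\<^sub>2) + 2 * (2 * \<rho>\<^sub>2 + \<rho>\<^sub>3)"
  shows "weyl g z p q r s = (\<rho>\<^sub>1 - 2 * \<rho>\<^sub>2 + \<rho>\<^sub>3) / 3 * block_weyl h k z p q r s"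
  unfolding weyl_def R \<kappa> block_weyl_def kulkarni_nomizu_def g S
  by (simp add: field_simps)

text \<open>The remaining terms of the Lie derivative contain derivatives of the constant components of
  \<open>\<xi>\<close>.\<close>

lemma lie_derivative4_coord_vector_x:
  "lie_derivative4 coord_vector_x T z p q r s = partial_deriv 3 (\<lambda>w. T w p q r s) z"
  by (simp add: lie_derivative4_def coord_vector_x_def sum_4 axis_def)

text \<open>By the product rule \<open>h \<and> h\<close> is annihilated, \<open>h \<and> k\<close> is multiplied by \<open>\<mu>\<close> and \<open>k \<and> k\<close> by \<open>2 \<mu>\<close>.\<close>

lemma partial_deriv_block_weyl:
  fixes h k :: "'n::finite tensor2"
  assumes w: "w differentiable (at z)"
    and h: "\<And>i j. (\<lambda>v. h v i j) differentiable (at z)" "\<And>i j. partial_deriv m (\<lambda>v. h v i j) z = 0"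
    and k: "\<And>i j. (\<lambda>v. k v i j) differentiable (at z)"
           "\<And>i j. partial_deriv m (\<lambda>v. k v i j) z = \<mu> * k z i j"
  shows "partial_deriv m (\<lambda>v. w v * block_weyl h k v p q r s) z
    = partial_deriv m w z * block_weyl h k z p q r s
      + w z * \<mu> * (kulkarni_nomizu k k z p q r s - (1/2) * kulkarni_nomizu h k z p q r s)"
proof -
  note D = has_real_derivative_partial_deriv[OF w, of m]
    has_real_derivative_partial_deriv[OF h(1), of m, unfolded h(2)]
    has_real_derivative_partial_deriv[OF k(1), of m, unfolded k(2)]
  show ?thesis
    unfolding partial_deriv_def[of m "\<lambda>v. w v * _ v"] block_weyl_def kulkarni_nomizu_def
    by (rule DERIV_imp_deriv)
      ((rule D derivative_eq_intros refl)+, simp add: field_simps)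
qed

text \<open>Both sides are combinations of \<open>h \<and> h\<close>, \<open>h \<and> k\<close> and \<open>k \<and> k\<close>. The difference of the equations for
  \<open>k \<and> k\<close> and \<open>h \<and> h\<close> is the condition on \<open>c\<^sub>2\<close>. Half their sum plus the equation for \<open>h \<and> k\<close> no longer
  contains \<open>w\<close> and gives \<open>c\<^sub>1\<close>; the sum of the equations for \<open>h \<and> h\<close> and \<open>k \<and> k\<close> then gives \<open>c\<close>.\<close>

lemma conformal_inheritance_two_block:
  assumes g: "\<And>i j. metric_tensor g z i j = h z i j + k z i j"
    and S: "\<And>i j. ricci g z i j = s\<^sub>1 * h z i j + s\<^sub>2 * k z i j"
    and l2: "w * \<mu> = c\<^sub>2 * (s\<^sub>2 - s\<^sub>1)"
    and l1: "c\<^sub>1 = - c\<^sub>2 * (s\<^sub>1 + s\<^sub>2) / 2"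
    and l: "c * w = w' + w * \<mu>"
  shows "w' * block_weyl h k z p q r s
      + w * \<mu> * (kulkarni_nomizu k k z p q r s - (1/2) * kulkarni_nomizu h k z p q r s)
    = c * (w * block_weyl h k z p q r s)
      + c\<^sub>1 * kulkarni_nomizu (metric_tensor g) (metric_tensor g) z p q r s
      + c\<^sub>2 * kulkarni_nomizu (metric_tensor g) (ricci g) z p q r s"
proof -
  define H where "H = kulkarni_nomizu h h z p q r s"
  define X where "X = kulkarni_nomizu h k z p q r s"
  define K where "K = kulkarni_nomizu k k z p q r s"
  have gg: "kulkarni_nomizu (metric_tensor g) (metric_tensor g) z p q r s = H + 2 * X + K"
    unfolding H_def X_def K_def kulkarni_nomizu_def g by (simp add: algebra_simps)
  have gS: "kulkarni_nomizu (metric_tensor g) (ricci g) z p q r s = s\<^sub>1 * H + (s\<^sub>1 + s\<^sub>2) * X + s\<^sub>2 * K"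
    unfolding H_def X_def K_def kulkarni_nomizu_def g S by (simp add: algebra_simps)
  have w': "w' = c * w - c\<^sub>2 * (s\<^sub>2 - s\<^sub>1)" using l l2 by simp
  show ?thesis
    unfolding gg gS block_weyl_def H_def[symmetric] X_def[symmetric] K_def[symmetric] l2 l1 w'
    by (simp add: field_simps)
qed


section \<open>Functions of the separated variables\<close>

lemma xy_part_line:
  "xy_part (z + h *\<^sub>R axis m 1) = xy_part z + h *\<^sub>R (if m = 3 then axis 1 1 else if m = 4 then axis 2 1 else 0)"
  using exhaust_4[of m] by (auto simp: xy_part_def vec_eq_iff forall_2 axis_def)

lemma bounded_linear_xy_part: "bounded_linear xy_part"
proof -
  have "xy_part x = (\<chi> i. if i = 1 then x $ 3 else x $ 4)" for x
    by (simp add: xy_part_def vec_eq_iff forall_2)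
  then have "linear xy_part"
    by (intro linearI) (simp_all add: vec_eq_iff)
  then show ?thesis by (simp add: linear_conv_bounded_linear)
qed

lemma partial_deriv_xy_part:
  "partial_deriv m (\<lambda>w. \<psi> (xy_part w)) z
    = (if m = 3 then partial_deriv 1 \<psi> (xy_part z) else if m = 4 then partial_deriv 2 \<psi> (xy_part z) else 0)"
  by (simp add: partial_deriv_def xy_part_line)

lemma differentiable_xy_part:
  assumes "\<psi> differentiable (at (xy_part z))"
  shows "(\<lambda>w. \<psi> (xy_part w)) differentiable (at z)"
  by (rule differentiable_compose[OF assms bounded_linear_imp_differentiable[OF bounded_linear_xy_part]])

lemma smooth_on_xy_part:
  assumes "smooth_on \<psi> \<Omega>" "xy_part ` U \<subseteq> \<Omega>"
  shows "smooth_on (\<lambda>w. \<psi> (xy_part w)) U"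
  unfolding smooth_on_def
proof
  fix k
  have "Ck_on k \<psi> \<Omega>" using assms(1) by (simp add: smooth_on_def)
  then show "Ck_on k (\<lambda>w. \<psi> (xy_part w)) U"
  proof (induction k arbitrary: \<psi>)
    case 0
    then show ?case
      using linear_continuous_on[OF bounded_linear_xy_part] assms(2)
      by (auto intro: continuous_on_compose2)
  next
    case (Suc k)
    have "Ck_on k (partial_deriv m (\<lambda>w. \<psi> (xy_part w))) U" for m
    proof -
      have "partial_deriv m (\<lambda>w. \<psi> (xy_part w)) = (if m = 3 then \<lambda>w. partial_deriv 1 \<psi> (xy_part w)
          else if m = 4 then \<lambda>w. partial_deriv 2 \<psi> (xy_part w) else (\<lambda>w. 0))"
        by (rule ext) (simp add: partial_deriv_xy_part)
      then show ?thesis using Suc by (simp add: Ck_on_const)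
    qed
    moreover have "(\<lambda>w. \<psi> (xy_part w)) differentiable (at p)" if "p \<in> U" for p
      using Suc.prems that assms(2) by (intro differentiable_xy_part) auto
    ultimately show ?case by simp
  qed
qed

text \<open>The metric components and most Christoffel symbols are products of a function of \<open>r\<close> and
  a function of \<open>(x, y)\<close>.\<close>

lemma partial_deriv_separated:
  assumes \<phi>: "(\<phi> has_real_derivative \<phi>') (at (z $ 2))" and \<psi>: "\<psi> differentiable (at (xy_part z))"
  shows "partial_deriv m (\<lambda>w. \<phi> (w $ 2) * \<psi> (xy_part w)) z
    = (if m = 2 then \<phi>' * \<psi> (xy_part z)
       else if m = 3 then \<phi> (z $ 2) * partial_deriv 1 \<psi> (xy_part z)
       else if m = 4 then \<phi> (z $ 2) * partial_deriv 2 \<psi> (xy_part z) else 0)"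
proof -
  have d: "((\<lambda>h. \<phi> ((z + h *\<^sub>R axis m 1) $ 2)) has_real_derivative (if m = 2 then \<phi>' else 0)) (at 0)"
  proof (cases "m = 2")
    case True
    have "((\<lambda>h. \<phi> (z $ 2 + h)) has_real_derivative \<phi>') (at 0)"
      using \<phi> DERIV_shift[of \<phi> \<phi>' 0 "z $ 2"] by (simp add: add.commute)
    with True show ?thesis by (simp add: axis_def)
  qed (simp add: axis_def)
  note e = has_real_derivative_partial_deriv[OF differentiable_xy_part[OF \<psi>], of m]
  show ?thesis
    unfolding partial_deriv_def[of m "\<lambda>w. \<phi> (w $ 2) * \<psi> (xy_part w)"]
    by (rule DERIV_imp_deriv, (rule derivative_eq_intros d e refl)+) (simp add: partial_deriv_xy_part)
qed

section \<open>Metric and connection of the Robinson--Trautman spacetime\<close>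

definition rt_base :: "real \<Rightarrow> real \<Rightarrow> real \<Rightarrow> 4 tensor2" where
  "rt_base a b d z i j =
     (if i = 1 \<and> j = 1 then - 2 * (a - 2 * b * z $ 2 - d / z $ 2)
      else if (i = 1 \<and> j = 2) \<or> (i = 2 \<and> j = 1) then 1 else 0)"

definition rt_fibre :: "(real^2 \<Rightarrow> real) \<Rightarrow> 4 tensor2" where
  "rt_fibre f z i j =
     (if (i = 3 \<and> j = 3) \<or> (i = 4 \<and> j = 4) then - ((z $ 2)\<^sup>2 / (f (xy_part z))\<^sup>2) else 0)"

lemma metric_tensor_rt_metric:
  "metric_tensor (rt_metric a b d f) z i j = rt_base a b d z i j + rt_fibre f z i j"
  by (auto simp: metric_tensor_def rt_metric_def rt_base_def rt_fibre_def Let_def)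

text \<open>The closed form is defined at every point, with no reference to the metric, so that it can be
  differentiated as a function. The conditions are arranged so that a choice of numerals for the indices
  reduces the table to a single entry. With \<open>A = a - 2 b r - d/r\<close> the entries for \<open>k = 1, 2\<close> are \<open>\<plusminus> A'\<close>,
  \<open>2 A A'\<close>, \<open>r/f\<^sup>2\<close> and \<open>2 A r/f\<^sup>2\<close>; those for \<open>k = 3, 4\<close> are \<open>1/r\<close> and the Christoffel symbols of the
  conformally flat surface metric \<open>(dx\<^sup>2 + dy\<^sup>2)/f\<^sup>2\<close>.\<close>

definition rt_christoffel :: "real \<Rightarrow> real \<Rightarrow> real \<Rightarrow> (real^2 \<Rightarrow> real) \<Rightarrow> real^4 \<Rightarrow> 4 \<Rightarrow> 4 \<Rightarrow> 4 \<Rightarrow> real" where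
  "rt_christoffel a b d f z k i j = (let r = z $ 2; u = xy_part z in
     if k = 1 then
       (if i = 1 \<and> j = 1 then d / r\<^sup>2 - 2 * b
        else if (i = 3 \<and> j = 3) \<or> (i = 4 \<and> j = 4) then r / (f u)\<^sup>2 else 0)
     else if k = 2 then
       (if i = 1 \<and> j = 1 then 2 * (a - 2 * b * r - d / r) * (d / r\<^sup>2 - 2 * b)
        else if (i = 1 \<and> j = 2) \<or> (i = 2 \<and> j = 1) then 2 * b - d / r\<^sup>2
        else if (i = 3 \<and> j = 3) \<or> (i = 4 \<and> j = 4) then 2 * (a - 2 * b * r - d / r) * r / (f u)\<^sup>2 else 0)
     else if k = 3 then
       (if (i = 2 \<and> j = 3) \<or> (i = 3 \<and> j = 2) then 1 / r
        else if i = 3 \<and> j = 3 then - (partial_deriv 1 f u / f u)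
        else if (i = 3 \<and> j = 4) \<or> (i = 4 \<and> j = 3) then - (partial_deriv 2 f u / f u)
        else if i = 4 \<and> j = 4 then partial_deriv 1 f u / f u else 0)
     else
       (if (i = 2 \<and> j = 4) \<or> (i = 4 \<and> j = 2) then 1 / r
        else if i = 3 \<and> j = 3 then partial_deriv 2 f u / f u
        else if (i = 3 \<and> j = 4) \<or> (i = 4 \<and> j = 3) then - (partial_deriv 1 f u / f u)
        else if i = 4 \<and> j = 4 then - (partial_deriv 2 f u / f u) else 0))"

locale robinson_trautman =
  fixes a b d :: real and I J :: "real set" and \<Omega> :: "(real^2) set" and f :: "real^2 \<Rightarrow> real"
  assumes open_I: "open I" and open_J: "open J" and zero_notin_J: "0 \<notin> J" and open_\<Omega>: "open \<Omega>"
    and f_smooth: "smooth_on f \<Omega>" and f_nonzero: "u \<in> \<Omega> \<Longrightarrow> f u \<noteq> 0"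
begin

abbreviation "M \<equiv> rt_manifold I J \<Omega>"
abbreviation "g \<equiv> rt_metric a b d f"

lemma open_M: "open M"
proof -
  have "M = (\<lambda>z. z $ 1) -` I \<inter> (\<lambda>z. z $ 2) -` J \<inter> xy_part -` \<Omega>"
    by (auto simp: rt_manifold_def)
  moreover have "continuous_on UNIV xy_part"
    using bounded_linear_xy_part by (rule linear_continuous_on)
  ultimately show ?thesis
    using open_I open_J open_\<Omega> by (auto intro!: open_Int open_vimage continuous_intros)
qed

lemma r_nonzero: "z \<in> M \<Longrightarrow> z $ 2 \<noteq> 0"
  and xy_part_M: "z \<in> M \<Longrightarrow> xy_part z \<in> \<Omega>"
  and f_xy_nonzero: "z \<in> M \<Longrightarrow> f (xy_part z) \<noteq> 0"
  using zero_notin_J f_nonzero by (auto simp: rt_manifold_def)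

lemma f_partial_differentiable:
  assumes "z \<in> M"
  shows "f differentiable (at (xy_part z))" "partial_deriv i f differentiable (at (xy_part z))"
  using smooth_on_differentiable[OF _ xy_part_M[OF assms]] f_smooth smooth_on_partial_deriv by blast+

lemma inverse_square_f:
  assumes "z \<in> M"
  shows "(\<lambda>u. 1 / (f u)\<^sup>2) differentiable (at (xy_part z))"
    and "partial_deriv i (\<lambda>u. 1 / (f u)\<^sup>2) (xy_part z)
      = - 2 * partial_deriv i f (xy_part z) / (f (xy_part z))^3"
proof -
  note nz = f_xy_nonzero[OF assms]
  note f_diff = f_partial_differentiable(1)[OF assms]
  show "(\<lambda>u. 1 / (f u)\<^sup>2) differentiable (at (xy_part z))"
    using nz f_diff by (intro differentiable_divide differentiable_power differentiable_const) auto
  show "partial_deriv i (\<lambda>u. 1 / (f u)\<^sup>2) (xy_part z)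
      = - 2 * partial_deriv i f (xy_part z) / (f (xy_part z))^3"
    unfolding partial_deriv_def[of i "\<lambda>u. 1 / (f u)\<^sup>2"]
    by (rule DERIV_imp_deriv, (rule derivative_eq_intros has_real_derivative_partial_deriv[OF f_diff] refl)+)
       (use nz in \<open>simp_all add: field_simps power2_eq_square power3_eq_cube\<close>)
qed

lemma inverse_metric_rt:
  assumes "z \<in> M"
  shows "inverse_metric g z i j =
    (if (i = 1 \<and> j = 2) \<or> (i = 2 \<and> j = 1) then 1
     else if i = 2 \<and> j = 2 then 2 * (a - 2 * b * z $ 2 - d / z $ 2)
     else if (i = 3 \<and> j = 3) \<or> (i = 4 \<and> j = 4) then - ((f (xy_part z))\<^sup>2 / (z $ 2)\<^sup>2) else 0)"
proof -
  define N :: "real^4^4" where "N = (\<chi> i j.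
     if (i = 1 \<and> j = 2) \<or> (i = 2 \<and> j = 1) then 1
     else if i = 2 \<and> j = 2 then 2 * (a - 2 * b * z $ 2 - d / z $ 2)
     else if (i = 3 \<and> j = 3) \<or> (i = 4 \<and> j = 4) then - ((f (xy_part z))\<^sup>2 / (z $ 2)\<^sup>2) else 0)"
  have "matrix_inv (g z) = N"
    by (rule matrix_inv_eqI)
       (simp_all add: N_def rt_metric_def matrix_matrix_mult_def mat_def vec_eq_iff forall_4 sum_4 Let_def
          r_nonzero[OF assms] f_xy_nonzero[OF assms])
  then show ?thesis by (simp add: inverse_metric_def N_def)
qed

lemma partial_deriv_metric:
  assumes "z \<in> M"
  shows "partial_deriv m (\<lambda>w. metric_tensor g w i j) z =
    (if i = 1 \<and> j = 1 then (if m = 2 then 2 * (2 * b - d / (z $ 2)\<^sup>2) else 0)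
     else if (i = 3 \<and> j = 3) \<or> (i = 4 \<and> j = 4) then
       (if m = 2 then - 2 * z $ 2 / (f (xy_part z))\<^sup>2
        else if m = 3 then 2 * (z $ 2)\<^sup>2 * partial_deriv 1 f (xy_part z) / (f (xy_part z))^3
        else if m = 4 then 2 * (z $ 2)\<^sup>2 * partial_deriv 2 f (xy_part z) / (f (xy_part z))^3
        else 0)
     else 0)"
proof -
  note nz = r_nonzero[OF assms] f_xy_nonzero[OF assms]
  have base: "partial_deriv m (\<lambda>w. - 2 * (a - 2 * b * w $ 2 - d / w $ 2)) z
      = (if m = 2 then 2 * (2 * b - d / (z $ 2)\<^sup>2) else 0)"
    using nz by (subst partial_deriv_separated[where \<psi> = "\<lambda>u. 1" and \<phi> = "\<lambda>r. - 2 * (a - 2 * b * r - d / r)",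
        simplified mult_1_right])
      (auto intro!: derivative_eq_intros simp: power2_eq_square)
  note pd = inverse_square_f(2)[OF assms]
  have fibre: "partial_deriv m (\<lambda>w. - ((w $ 2)\<^sup>2 / (f (xy_part w))\<^sup>2)) z
      = (if m = 2 then - 2 * z $ 2 / (f (xy_part z))\<^sup>2
        else if m = 3 then 2 * (z $ 2)\<^sup>2 * partial_deriv 1 f (xy_part z) / (f (xy_part z))^3
        else if m = 4 then 2 * (z $ 2)\<^sup>2 * partial_deriv 2 f (xy_part z) / (f (xy_part z))^3
        else 0)"
  proof -
    have "(\<lambda>w::real^4. - ((w $ 2)\<^sup>2 / (f (xy_part w))\<^sup>2)) = (\<lambda>w. - ((w $ 2)\<^sup>2) * (1 / (f (xy_part w))\<^sup>2))"
      by auto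
    moreover have "((\<lambda>r::real. - (r\<^sup>2)) has_real_derivative - 2 * z $ 2) (at (z $ 2))"
      by (auto intro!: derivative_eq_intros)
    moreover have "(\<lambda>u. 1 / (f u)\<^sup>2) differentiable (at (xy_part z))"
      by (rule inverse_square_f(1)[OF assms])
    ultimately show ?thesis
      using partial_deriv_separated[of "\<lambda>r. - (r\<^sup>2)" "- 2 * z $ 2" z "\<lambda>u. 1 / (f u)\<^sup>2" m]
      by (simp add: pd)
  qed
  show ?thesis
    unfolding metric_tensor_rt_metric rt_base_def rt_fibre_def
    using base fibre by auto
qed


lemma christoffel_rt:
  assumes "z \<in> M"
  shows "christoffel g z k i j = rt_christoffel a b d f z k i j"
proof -
  note nz = r_nonzero[OF assms] f_xy_nonzero[OF assms]
  have "\<forall>k i j. christoffel g z k i j = rt_christoffel a b d f z k i j"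
    unfolding forall_4 christoffel_def inverse_metric_rt[OF assms] partial_deriv_metric[OF assms]
      rt_christoffel_def sum_4 Let_def
    using nz by (simp add: field_simps power2_eq_square power3_eq_cube)
  then show ?thesis by blast
qed

text \<open>The following lemmas differentiate every entry of the table. Their left-hand sides are written exactly
  as the entries appear in the table, so that they can serve as rewrite rules on its instances.\<close>

lemma partial_deriv_radial:
  assumes "z \<in> M"
  shows "partial_deriv m (\<lambda>w. d / (w $ 2)\<^sup>2 - 2 * b) z = (if m = 2 then - 2 * d / (z $ 2)^3 else 0)"
    and "partial_deriv m (\<lambda>w. 2 * b - d / (w $ 2)\<^sup>2) z = (if m = 2 then 2 * d / (z $ 2)^3 else 0)"
    and "partial_deriv m (\<lambda>w. 2 * (a - 2 * b * w $ 2 - d / w $ 2) * (d / (w $ 2)\<^sup>2 - 2 * b)) z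
      = (if m = 2 then 2 * (d / (z $ 2)\<^sup>2 - 2 * b)\<^sup>2 - 4 * (a - 2 * b * z $ 2 - d / z $ 2) * d / (z $ 2)^3 else 0)"
    and "partial_deriv m (\<lambda>w. 1 / w $ 2) z = (if m = 2 then - 1 / (z $ 2)\<^sup>2 else 0)"
proof -
  note nz = r_nonzero[OF assms]
  have radial: "partial_deriv m (\<lambda>w. \<phi> (w $ 2)) z = (if m = 2 then D else 0)"
    if "(\<phi> has_real_derivative D) (at (z $ 2))" for \<phi> D
    using partial_deriv_separated[OF that, of "\<lambda>u. 1" m] by simp
  show "partial_deriv m (\<lambda>w. d / (w $ 2)\<^sup>2 - 2 * b) z = (if m = 2 then - 2 * d / (z $ 2)^3 else 0)"
    by (rule radial)
       (use nz in \<open>auto intro!: derivative_eq_intros simp: field_simps power2_eq_square power3_eq_cube\<close>)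
  show "partial_deriv m (\<lambda>w. 2 * b - d / (w $ 2)\<^sup>2) z = (if m = 2 then 2 * d / (z $ 2)^3 else 0)"
    by (rule radial)
       (use nz in \<open>auto intro!: derivative_eq_intros simp: field_simps power2_eq_square power3_eq_cube\<close>)
  show "partial_deriv m (\<lambda>w. 2 * (a - 2 * b * w $ 2 - d / w $ 2) * (d / (w $ 2)\<^sup>2 - 2 * b)) z
      = (if m = 2 then 2 * (d / (z $ 2)\<^sup>2 - 2 * b)\<^sup>2 - 4 * (a - 2 * b * z $ 2 - d / z $ 2) * d / (z $ 2)^3 else 0)"
    by (rule radial, (rule derivative_eq_intros refl | (simp add: nz; fail))+)
       (use nz in \<open>simp_all add: field_simps power2_eq_square power3_eq_cube\<close>)
  show "partial_deriv m (\<lambda>w. 1 / w $ 2) z = (if m = 2 then - 1 / (z $ 2)\<^sup>2 else 0)"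
    by (rule radial)
       (use nz in \<open>auto intro!: derivative_eq_intros simp: field_simps power2_eq_square power3_eq_cube\<close>)
qed

lemma partial_deriv_mixed:
  assumes "z \<in> M"
  shows "partial_deriv m (\<lambda>w. w $ 2 / (f (xy_part w))\<^sup>2) z =
      (if m = 2 then 1 / (f (xy_part z))\<^sup>2
       else if m = 3 then - 2 * z $ 2 * partial_deriv 1 f (xy_part z) / (f (xy_part z))^3
       else if m = 4 then - 2 * z $ 2 * partial_deriv 2 f (xy_part z) / (f (xy_part z))^3 else 0)"
    and "partial_deriv m (\<lambda>w. 2 * (a - 2 * b * w $ 2 - d / w $ 2) * w $ 2 / (f (xy_part w))\<^sup>2) z =
      (if m = 2 then (2 * a - 8 * b * z $ 2) / (f (xy_part z))\<^sup>2
       else if m = 3 then 2 * (a - 2 * b * z $ 2 - d / z $ 2) * z $ 2 * (- 2 * partial_deriv 1 f (xy_part z)) / (f (xy_part z))^3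
       else if m = 4 then 2 * (a - 2 * b * z $ 2 - d / z $ 2) * z $ 2 * (- 2 * partial_deriv 2 f (xy_part z)) / (f (xy_part z))^3
       else 0)"
proof -
  note nz = r_nonzero[OF assms] f_xy_nonzero[OF assms]
  note pd = inverse_square_f(2)[OF assms]
  note sep = partial_deriv_separated[OF _ inverse_square_f(1)[OF assms], of _ _ m, unfolded pd]
  show "partial_deriv m (\<lambda>w. w $ 2 / (f (xy_part w))\<^sup>2) z =
      (if m = 2 then 1 / (f (xy_part z))\<^sup>2
       else if m = 3 then - 2 * z $ 2 * partial_deriv 1 f (xy_part z) / (f (xy_part z))^3
       else if m = 4 then - 2 * z $ 2 * partial_deriv 2 f (xy_part z) / (f (xy_part z))^3 else 0)"
    using sep[of "\<lambda>r. r" 1] by (simp add: algebra_simps)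
  have "((\<lambda>r. 2 * (a - 2 * b * r - d / r) * r) has_real_derivative (2 * a - 8 * b * z $ 2)) (at (z $ 2))"
    by ((rule derivative_eq_intros refl | (simp add: nz; fail))+)
       (use nz in \<open>simp_all add: field_simps power2_eq_square\<close>)
  from sep[OF this] show "partial_deriv m (\<lambda>w. 2 * (a - 2 * b * w $ 2 - d / w $ 2) * w $ 2 / (f (xy_part w))\<^sup>2) z =
      (if m = 2 then (2 * a - 8 * b * z $ 2) / (f (xy_part z))\<^sup>2
       else if m = 3 then 2 * (a - 2 * b * z $ 2 - d / z $ 2) * z $ 2 * (- 2 * partial_deriv 1 f (xy_part z)) / (f (xy_part z))^3
       else if m = 4 then 2 * (a - 2 * b * z $ 2 - d / z $ 2) * z $ 2 * (- 2 * partial_deriv 2 f (xy_part z)) / (f (xy_part z))^3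
       else 0)"
    by (simp only: times_divide_eq_right mult_1_right)
qed

lemma partial_deriv_log_deriv:
  assumes "z \<in> M"
  shows "partial_deriv m (\<lambda>w. partial_deriv j f (xy_part w) / f (xy_part w)) z =
     (if m = 3 then partial_deriv 1 (partial_deriv j f) (xy_part z) / f (xy_part z)
         - partial_deriv 1 f (xy_part z) * partial_deriv j f (xy_part z) / (f (xy_part z))\<^sup>2
      else if m = 4 then partial_deriv 2 (partial_deriv j f) (xy_part z) / f (xy_part z)
         - partial_deriv 2 f (xy_part z) * partial_deriv j f (xy_part z) / (f (xy_part z))\<^sup>2
      else 0)" (is ?A)
    and "partial_deriv m (\<lambda>w. - (partial_deriv j f (xy_part w) / f (xy_part w))) z =
     - partial_deriv m (\<lambda>w. partial_deriv j f (xy_part w) / f (xy_part w)) z" (is ?B)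
proof -
  note nz = f_xy_nonzero[OF assms]
  note f_diff = f_partial_differentiable[OF assms]
  have "partial_deriv i (\<lambda>u. partial_deriv j f u / f u) (xy_part z)
      = partial_deriv i (partial_deriv j f) (xy_part z) / f (xy_part z)
         - partial_deriv i f (xy_part z) * partial_deriv j f (xy_part z) / (f (xy_part z))\<^sup>2" for i
    unfolding partial_deriv_def[of i "\<lambda>u. partial_deriv j f u / f u"]
    by (rule DERIV_imp_deriv, (rule derivative_eq_intros has_real_derivative_partial_deriv[OF f_diff(1)]
          has_real_derivative_partial_deriv[OF f_diff(2)] refl)+)
       (use nz in \<open>simp_all add: field_simps power2_eq_square power3_eq_cube\<close>)
  then show ?A
    using partial_deriv_xy_part[of m "\<lambda>u. partial_deriv j f u / f u" z] by simp
  show ?B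
    by (intro partial_deriv_minus differentiable_xy_part[where \<psi> = "\<lambda>u. partial_deriv j f u / f u"]
        differentiable_divide f_diff nz)
qed

lemma partial_deriv_christoffel:
  assumes "z \<in> M"
  shows "partial_deriv m (\<lambda>w. christoffel g w k i j) z = partial_deriv m (\<lambda>w. rt_christoffel a b d f w k i j) z"
  by (rule partial_deriv_cong_open[OF open_M assms]) (rule christoffel_rt)


section \<open>Curvature\<close>

text \<open>The Gauss curvature of the base, the curvature shared by the planes spanned by one base and one fibre
  direction, and the curvature of the fibre corrected by its bending in the warped product, all for the
  sign with which \<open>R = (\<rho>/2) g \<and> g\<close> in constant curvature \<open>\<rho>\<close>.\<close>

definition "base_curvature z = - 2 * d / (z $ 2)^3"
definition "mixed_curvature z = d / (z $ 2)^3 - 2 * b / z $ 2"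
definition "fibre_curvature z = - (F1 f (xy_part z) - 2 * a + 4 * b * z $ 2) / (z $ 2)\<^sup>2 - 2 * d / (z $ 2)^3"

definition warped_curvature :: "4 tensor4" where
  "warped_curvature z p q r s =
     base_curvature z / 2 * kulkarni_nomizu (rt_base a b d) (rt_base a b d) z p q r s
     + mixed_curvature z * kulkarni_nomizu (rt_base a b d) (rt_fibre f) z p q r s
     + fibre_curvature z / 2 * kulkarni_nomizu (rt_fibre f) (rt_fibre f) z p q r s"

lemma f_mixed_commute:
  assumes "z \<in> M"
  shows "partial_deriv 1 (partial_deriv 2 f) (xy_part z) = partial_deriv 2 (partial_deriv 1 f) (xy_part z)"
  by (rule smooth_on_partial_deriv_commute[OF open_\<Omega> f_smooth xy_part_M[OF assms]])

text \<open>A direct evaluation of the remaining 96 components. Most are zero; for \<open>(r, s) = (3, 4)\<close> some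
  cancel only because the mixed second derivatives of \<open>f\<close> agree.\<close>

lemma riemann_rt_pair:
  assumes "z \<in> M" and rs: "(r, s) \<in> {(1,2),(1,3),(1,4),(2,3),(2,4),(3,4)}"
  shows "riemann g z p q r s = warped_curvature z p q r s"
proof -
  note nz = r_nonzero[OF assms(1)] f_xy_nonzero[OF assms(1)]
  note eqs = riemann_def sum_4 metric_tensor_rt_metric rt_base_def rt_fibre_def
    christoffel_rt[OF assms(1)] partial_deriv_christoffel[OF assms(1)] rt_christoffel_def
    partial_deriv_radial[OF assms(1)] partial_deriv_mixed[OF assms(1)] partial_deriv_log_deriv[OF assms(1)]
    f_mixed_commute[OF assms(1)] warped_curvature_def base_curvature_def mixed_curvature_def fibre_curvature_def kulkarni_nomizu_def
    F1_def Let_def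
  have "r = 1 \<and> s = 2 \<or> r = 1 \<and> s = 3 \<or> r = 1 \<and> s = 4 \<or> r = 2 \<and> s = 3 \<or> r = 2 \<and> s = 4 \<or> r = 3 \<and> s = 4"
    using rs by simp
  \<comment> \<open>Distributing numerals would change the entries of the Christoffel table before
    they meet the rules for their derivatives.\<close>
  then show ?thesis
    using exhaust_4[of p] exhaust_4[of q] nz
    by (elim disjE conjE; hypsubst;
        simp add: eqs del: right_diff_distrib_numeral left_diff_distrib_numeral;
        simp add: field_simps power2_eq_square power3_eq_cube power4_eq_xxxx)
qed

lemma riemann_rt:
  assumes "z \<in> M"
  shows "riemann g z p q r s = warped_curvature z p q r s"
proof -
  have skew: "warped_curvature z p q s r = - warped_curvature z p q r s" for r s
    unfolding warped_curvature_def kulkarni_nomizu_skew_last[of _ _ z p q s r] by (simp add: algebra_simps)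
  have diag: "riemann g z p q r r = warped_curvature z p q r r" for r
    using riemann_skew_last[of g z p q r r] skew[of r r] by simp
  consider "(r, s) \<in> {(1,2),(1,3),(1,4),(2,3),(2,4),(3,4)}" | "(s, r) \<in> {(1,2),(1,3),(1,4),(2,3),(2,4),(3,4)}"
    | "r = s"
    using exhaust_4[of r] exhaust_4[of s] by auto
  then show ?thesis
  proof cases
    case 1
    then show ?thesis by (rule riemann_rt_pair[OF assms])
  next
    case 2
    from riemann_rt_pair[OF assms this, of p q] show ?thesis
      by (simp add: riemann_skew_last[of g z p q s r] skew[of s r])
  next
    case 3
    with diag show ?thesis by simp
  qed
qed

text \<open>Each block has rank two, so contracting \<open>h \<and> h\<close> returns \<open>2 h\<close>, \<open>h \<and> k\<close> returns \<open>2 h + 2 k\<close> and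
  \<open>k \<and> k\<close> returns \<open>2 k\<close>.\<close>

lemma ricci_rt:
  assumes "z \<in> M"
  shows "ricci g z i j = (base_curvature z + 2 * mixed_curvature z) * rt_base a b d z i j
       + (2 * mixed_curvature z + fibre_curvature z) * rt_fibre f z i j"
  using exhaust_4[of i] exhaust_4[of j] r_nonzero[OF assms] f_xy_nonzero[OF assms]
  by (elim disjE; hypsubst;
      simp add: ricci_def sum_4 inverse_metric_rt[OF assms] riemann_rt[OF assms] warped_curvature_def
        kulkarni_nomizu_def rt_base_def rt_fibre_def;
      simp add: field_simps power2_eq_square power4_eq_xxxx)

lemma scalar_curvature_rt:
  assumes "z \<in> M"
  shows "scalar_curvature g z = 2 * (base_curvature z + 2 * mixed_curvature z) + 2 * (2 * mixed_curvature z + fibre_curvature z)"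
  using r_nonzero[OF assms] f_xy_nonzero[OF assms]
  by (simp add: scalar_curvature_def sum_4 inverse_metric_rt[OF assms] ricci_rt[OF assms] rt_base_def rt_fibre_def
     field_simps)

definition "weyl_coefficient z = - (6 * d + z $ 2 * F1 f (xy_part z) - 2 * a * z $ 2) / (3 * (z $ 2)^3)"

lemma weyl_rt:
  assumes "z \<in> M"
  shows "weyl g z p q r s = weyl_coefficient z * block_weyl (rt_base a b d) (rt_fibre f) z p q r s"
proof -
  have "(base_curvature z - 2 * mixed_curvature z + fibre_curvature z) / 3 = weyl_coefficient z"
    using r_nonzero[OF assms]
    by (simp add: base_curvature_def mixed_curvature_def fibre_curvature_def weyl_coefficient_def field_simps power2_eq_square power3_eq_cube)
  then show ?thesis
    using weyl_two_block[OF metric_tensor_rt_metric riemann_rt[OF assms, unfolded warped_curvature_def]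
       ricci_rt[OF assms] scalar_curvature_rt[OF assms], of p q r s] by simp
qed

section \<open>Smoothness and the derivatives in the direction of x\<close>

lemmas smooth_on_M_intros = smooth_on_const smooth_on_nth smooth_on_add[OF open_M] smooth_on_diff[OF open_M]
  smooth_on_minus[OF open_M] smooth_on_mult[OF open_M] smooth_on_power[OF open_M] smooth_on_divide[OF open_M]
  smooth_on_if

lemma smooth_on_M_xy: "smooth_on \<psi> \<Omega> \<Longrightarrow> smooth_on (\<lambda>z. \<psi> (xy_part z)) M"
  by (rule smooth_on_xy_part) (auto dest: xy_part_M)

lemmas smooth_on_f_partials = f_smooth smooth_on_partial_deriv[OF f_smooth]
  smooth_on_partial_deriv[OF smooth_on_partial_deriv[OF f_smooth]]
  smooth_on_partial_deriv[OF smooth_on_partial_deriv[OF smooth_on_partial_deriv[OF f_smooth]]]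

lemma smooth_on_F1: "smooth_on (F1 f) \<Omega>"
proof -
  have "F1 f = (\<lambda>u. (partial_deriv 1 f u)\<^sup>2 + (partial_deriv 2 f u)\<^sup>2
     - f u * (partial_deriv 1 (partial_deriv 1 f) u + partial_deriv 2 (partial_deriv 2 f) u))"
    by (rule ext) (simp add: F1_def Let_def)
  then show ?thesis
    by (simp only:) (intro smooth_on_diff[OF open_\<Omega>] smooth_on_add[OF open_\<Omega>] smooth_on_mult[OF open_\<Omega>]
        smooth_on_power[OF open_\<Omega>] smooth_on_f_partials)
qed

lemma smooth_on_F5: "smooth_on (F5 a d f) M"
proof -
  have "smooth_on (\<lambda>z. F5 a d f z) M"
    unfolding F5_def Let_def
    by (intro smooth_on_M_intros smooth_on_M_xy smooth_on_f_partials)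
  then show ?thesis .
qed

lemma smooth_on_weyl_coefficient: "smooth_on weyl_coefficient M"
proof -
  have "smooth_on (\<lambda>z. weyl_coefficient z) M"
    unfolding weyl_coefficient_def
    by (intro smooth_on_M_intros smooth_on_M_xy smooth_on_F1) (simp add: r_nonzero)
  then show ?thesis .
qed

lemma smooth_on_rt_base: "smooth_on (\<lambda>z. rt_base a b d z i j) M"
  unfolding rt_base_def by (intro smooth_on_M_intros r_nonzero)

lemma smooth_on_rt_fibre: "smooth_on (\<lambda>z. rt_fibre f z i j) M"
  unfolding rt_fibre_def
  by (intro smooth_on_M_intros smooth_on_M_xy smooth_on_f_partials) (simp add: f_xy_nonzero)

lemma partial_deriv_x_rt_base: "partial_deriv 3 (\<lambda>v. rt_base a b d v i j) z = 0"
proof -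
  have "rt_base a b d (z + h *\<^sub>R axis 3 1) i j = rt_base a b d z i j" for h
    by (simp add: rt_base_def axis_def)
  then show ?thesis by (simp add: partial_deriv_def)
qed

text \<open>The fibre metric depends on \<open>x\<close> only through its conformal factor, so its derivative is a multiple of
  itself.\<close>

lemma partial_deriv_x_rt_fibre:
  assumes "z \<in> M"
  shows "partial_deriv 3 (\<lambda>v. rt_fibre f v i j) z
    = - 2 * partial_deriv 1 f (xy_part z) / f (xy_part z) * rt_fibre f z i j"
proof (cases "(i = 3 \<and> j = 3) \<or> (i = 4 \<and> j = 4)")
  case True
  then have "(\<lambda>v. rt_fibre f v i j) = (\<lambda>v. metric_tensor g v i j)"
    by (auto simp: metric_tensor_rt_metric rt_base_def)
  then show ?thesis
    using True f_xy_nonzero[OF assms]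
    by (auto simp: partial_deriv_metric[OF assms] rt_fibre_def field_simps power2_eq_square power3_eq_cube)
next
  case False
  then show ?thesis unfolding rt_fibre_def if_not_P[OF False] by simp
qed

text \<open>The order of the derivatives on the right is the one used in \<open>F5\<close>. Bringing \<open>\<partial>\<^sub>x \<partial>\<^sub>y \<partial>\<^sub>y f\<close> to that
  order takes two exchanges: one applied to \<open>\<partial>\<^sub>y f\<close>, the other to \<open>f\<close> under an outer derivative in \<open>y\<close>.\<close>

lemma partial_deriv_x_F1:
  assumes "u \<in> \<Omega>"
  shows "partial_deriv 1 (F1 f) u = partial_deriv 1 f u * partial_deriv 1 (partial_deriv 1 f) u
     + 2 * partial_deriv 2 f u * partial_deriv 2 (partial_deriv 1 f) u
     - partial_deriv 1 f u * partial_deriv 2 (partial_deriv 2 f) u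
     - f u * (partial_deriv 1 (partial_deriv 1 (partial_deriv 1 f)) u
              + partial_deriv 2 (partial_deriv 2 (partial_deriv 1 f)) u)"
proof -
  have fxy: "partial_deriv 1 (partial_deriv 2 f) v = partial_deriv 2 (partial_deriv 1 f) v" if "v \<in> \<Omega>" for v
    by (rule smooth_on_partial_deriv_commute[OF open_\<Omega> f_smooth that])
  have "partial_deriv 1 (partial_deriv 2 (partial_deriv 2 f)) u = partial_deriv 2 (partial_deriv 1 (partial_deriv 2 f)) u"
    by (rule smooth_on_partial_deriv_commute[OF open_\<Omega> smooth_on_partial_deriv[OF f_smooth] assms])
  also have "\<dots> = partial_deriv 2 (partial_deriv 2 (partial_deriv 1 f)) u"
    by (rule partial_deriv_cong_open[OF open_\<Omega> assms fxy])
  finally have fxyy: "partial_deriv 1 (partial_deriv 2 (partial_deriv 2 f)) u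
      = partial_deriv 2 (partial_deriv 2 (partial_deriv 1 f)) u" .
  note D = smooth_on_f_partials[THEN smooth_on_differentiable[OF _ assms], THEN has_real_derivative_partial_deriv]
  show ?thesis
    unfolding partial_deriv_def[of 1 "F1 f"] F1_def Let_def
    by (rule DERIV_imp_deriv, (rule D derivative_eq_intros refl)+)
       (simp add: fxy[OF assms] fxyy algebra_simps)
qed

lemma partial_deriv_x_weyl_coefficient:
  assumes "z \<in> M"
  shows "partial_deriv 3 weyl_coefficient z = - partial_deriv 1 (F1 f) (xy_part z) / (3 * (z $ 2)\<^sup>2)"
proof -
  note D = has_real_derivative_partial_deriv[OF smooth_on_differentiable[OF smooth_on_F1 xy_part_M[OF assms]]]
  have "partial_deriv 3 weyl_coefficient z
    = deriv (\<lambda>h. - (6 * d + z $ 2 * F1 f (xy_part z + h *\<^sub>R axis 1 1) - 2 * a * z $ 2) / (3 * (z $ 2)^3)) 0"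
  proof -
    have r: "(z + h *\<^sub>R axis 3 1) $ 2 = z $ 2" for h
      by (simp add: axis_def)
    show ?thesis
      by (simp add: partial_deriv_def weyl_coefficient_def xy_part_line r del: vector_add_component)
  qed
  also have "\<dots> = - partial_deriv 1 (F1 f) (xy_part z) / (3 * (z $ 2)\<^sup>2)"
    by (rule DERIV_imp_deriv, (rule D derivative_eq_intros refl | (simp add: r_nonzero[OF assms]; fail))+)
       (use r_nonzero[OF assms] in \<open>simp add: field_simps power2_eq_square power3_eq_cube\<close>)
  finally show ?thesis .
qed

section \<open>The inheritance coefficients\<close>

text \<open>The three conditions on the coefficients, checked for the explicit formulas. With
  \<open>P = 6 d + r F\<^sub>1 - 2 a r\<close> and \<open>D = F\<^sub>1 - 2 a + 4 b r\<close> the long expressions factor: the bracket of \<open>\<lambda>\<^sub>1\<close> is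
  \<open>f\<^sub>x P (D + 8 b r)\<close>, and \<open>F\<^sub>5 = r f \<partial>\<^sub>x F\<^sub>1 - 2 f\<^sub>x P\<close>.\<close>

lemma inheritance_coefficients:
  assumes z: "z \<in> M"
    and nondeg: "F1 f (xy_part z) - 2 * a + 4 * b * z $ 2 \<noteq> 0"
      "z $ 2 * F1 f (xy_part z) - 2 * a * z $ 2 + 6 * d \<noteq> 0"
  defines "\<mu> \<equiv> - 2 * partial_deriv 1 f (xy_part z) / f (xy_part z)"
  shows "weyl_coefficient z * \<mu> = lambda_2 a b d f z
      * (2 * mixed_curvature z + fibre_curvature z - (base_curvature z + 2 * mixed_curvature z))"
    and "lambda_1 a b d f z = - lambda_2 a b d f z
      * (base_curvature z + 2 * mixed_curvature z + (2 * mixed_curvature z + fibre_curvature z)) / 2"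
    and "lambda_C a d f z * weyl_coefficient z = partial_deriv 3 weyl_coefficient z + weyl_coefficient z * \<mu>"
proof -
  define r where "r = z $ 2"
  define u where "u = xy_part z"
  define P where "P = 6 * d + r * F1 f u - 2 * a * r"
  define D where "D = F1 f u - 2 * a + 4 * b * r"
  have nz: "r \<noteq> 0" "f u \<noteq> 0" "D \<noteq> 0" "P \<noteq> 0"
    using r_nonzero[OF z] f_xy_nonzero[OF z] nondeg
    by (auto simp: r_def u_def P_def D_def algebra_simps)
  have negP: "- 6 * d + 2 * a * r - r * F1 f u = - P"
    by (simp add: P_def)
  have w: "weyl_coefficient z = - P / (3 * r^3)"
    by (simp add: weyl_coefficient_def r_def u_def P_def)
  have s1: "base_curvature z + 2 * mixed_curvature z = - 4 * b / r"
    using nz by (simp add: base_curvature_def mixed_curvature_def r_def field_simps power3_eq_cube)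
  have s2: "2 * mixed_curvature z + fibre_curvature z = - (D + 4 * b * r) / r\<^sup>2"
    using nz by (simp add: fibre_curvature_def mixed_curvature_def D_def flip: r_def u_def)
      (simp add: field_simps power2_eq_square power3_eq_cube)
  have l2: "lambda_2 a b d f z = - 2 * partial_deriv 1 f u * P / (3 * r * f u * D)"
    unfolding lambda_2_def Let_def r_def[symmetric] u_def[symmetric] negP D_def[symmetric] by simp
  have l1: "lambda_1 a b d f z = - partial_deriv 1 f u * P * (D + 8 * b * r) / (3 * r^3 * f u * D)"
  proof -
    have bracket: "((- 12 * a * d + 4 * a\<^sup>2 * r + 72 * b * d * r - 24 * a * b * r\<^sup>2) * partial_deriv 1 f u
     + (6 * d - 4 * a * r + 12 * b * r\<^sup>2)
         * ((partial_deriv 2 f u)\<^sup>2 * partial_deriv 1 f u - f u * partial_deriv 2 (partial_deriv 2 f) u * partial_deriv 1 f u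
            + (partial_deriv 1 f u)^3 - f u * partial_deriv 1 f u * partial_deriv 1 (partial_deriv 1 f) u)
     + r * partial_deriv 1 f u * ((partial_deriv 1 f u)^4 + (partial_deriv 2 f u)^4)
     - 2 * r * f u * (partial_deriv 2 f u)\<^sup>2 * partial_deriv 1 f u * (partial_deriv 1 (partial_deriv 1 f) u + partial_deriv 2 (partial_deriv 2 f) u)
     + r * (f u)\<^sup>2 * partial_deriv 1 f u * (partial_deriv 1 (partial_deriv 1 f) u + partial_deriv 2 (partial_deriv 2 f) u)\<^sup>2
     + 2 * r * (partial_deriv 1 f u)^3 * ((partial_deriv 2 f u)\<^sup>2 - f u * partial_deriv 1 (partial_deriv 1 f) u - f u * partial_deriv 2 (partial_deriv 2 f) u))
      = partial_deriv 1 f u * P * (D + 8 * b * r)"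
      unfolding P_def D_def F1_def Let_def by algebra
    show ?thesis
      unfolding lambda_1_def Let_def r_def[symmetric] u_def[symmetric] D_def[symmetric] bracket by simp
  qed
  have lC: "lambda_C a d f z = r * partial_deriv 1 (F1 f) u / P + \<mu>"
  proof -
    have "u \<in> \<Omega>" using xy_part_M[OF z] by (simp add: u_def)
    have "F5 a d f z = r * f u * partial_deriv 1 (F1 f) u - 2 * partial_deriv 1 f u * P"
      unfolding partial_deriv_x_F1[OF \<open>u \<in> \<Omega>\<close>] F5_def F1_def Let_def P_def u_def[symmetric] r_def[symmetric]
      by algebra
    moreover have "lambda_C a d f z = F5 a d f z / (f u * P)"
      unfolding lambda_C_def Let_def r_def[symmetric] u_def[symmetric] negP by simp
    ultimately show ?thesis
      using nz by (simp add: \<mu>_def field_simps flip: r_def u_def)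
  qed
  have w': "partial_deriv 3 weyl_coefficient z = - partial_deriv 1 (F1 f) u / (3 * r\<^sup>2)"
    unfolding r_def u_def by (rule partial_deriv_x_weyl_coefficient[OF z])
  have \<mu>: "\<mu> = - 2 * partial_deriv 1 f u / f u"
    by (simp add: \<mu>_def u_def)
  show "weyl_coefficient z * \<mu> = lambda_2 a b d f z
      * (2 * mixed_curvature z + fibre_curvature z - (base_curvature z + 2 * mixed_curvature z))"
    unfolding s1 s2 w l2 \<mu> using nz by (simp add: field_simps power2_eq_square power3_eq_cube)
  show "lambda_1 a b d f z = - lambda_2 a b d f z
      * (base_curvature z + 2 * mixed_curvature z + (2 * mixed_curvature z + fibre_curvature z)) / 2"
    unfolding s1 s2 l1 l2 using nz by (simp add: field_simps power2_eq_square power3_eq_cube)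
  show "lambda_C a d f z * weyl_coefficient z = partial_deriv 3 weyl_coefficient z + weyl_coefficient z * \<mu>"
    unfolding lC w w' using nz by (simp add: field_simps power2_eq_square power3_eq_cube)
qed

end

theorem proposition4p3:
  fixes a b d :: real and I J :: "real set" and \<Omega> :: "(real^2) set" and f :: "real^2 \<Rightarrow> real"
  assumes I: "open I" "is_interval I" "I \<noteq> {}"
    and J: "open J" "is_interval J" "J \<noteq> {}" "0 \<notin> J"
    and \<Omega>: "open \<Omega>" "connected \<Omega>" "\<Omega> \<noteq> {}"
    and f_smooth: "smooth_on f \<Omega>"
    and f_nonzero: "\<And>u. u \<in> \<Omega> \<Longrightarrow> f u \<noteq> 0"
    and nondeg1: "\<And>z. z \<in> rt_manifold I J \<Omega> \<Longrightarrow> F1 f (xy_part z) - 2 * a + 4 * b * z $ 2 \<noteq> 0"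
    and nondeg2: "\<And>z. z \<in> rt_manifold I J \<Omega> \<Longrightarrow>
                    z $ 2 * F1 f (xy_part z) - 2 * a * z $ 2 + 6 * d \<noteq> 0"
  shows "generalized_weyl_conformal_inheritance (rt_manifold I J \<Omega>) (rt_metric a b d f)
           coord_vector_x (lambda_C a d f) (lambda_1 a b d f) (lambda_2 a b d f)"
proof -
  interpret robinson_trautman a b d I J \<Omega> f
    using I(1) J(1,4) \<Omega>(1) f_smooth f_nonzero by unfold_locales auto
  note smooth = smooth_on_M_intros smooth_on_M_xy smooth_on_f_partials smooth_on_F1 smooth_on_F5
  have den2: "- 6 * d + 2 * a * z $ 2 - z $ 2 * F1 f (xy_part z) \<noteq> 0" if "z \<in> M" for z
    using nondeg2[OF that] by (simp add: algebra_simps)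
  have "smooth_on (\<lambda>z. lambda_C a d f z) M"
    unfolding lambda_C_def Let_def by (intro smooth no_zero_divisors den2 f_xy_nonzero)
  moreover have "smooth_on (\<lambda>z. lambda_1 a b d f z) M"
    unfolding lambda_1_def Let_def by (intro smooth no_zero_divisors nondeg1 f_xy_nonzero) (simp_all add: r_nonzero)
  moreover have "smooth_on (\<lambda>z. lambda_2 a b d f z) M"
    unfolding lambda_2_def Let_def by (intro smooth no_zero_divisors nondeg1 f_xy_nonzero) (simp_all add: r_nonzero)
  moreover have "lie_derivative4 coord_vector_x (weyl g) z p q r s =
          lambda_C a d f z * weyl g z p q r s
        + lambda_1 a b d f z * kulkarni_nomizu (metric_tensor g) (metric_tensor g) z p q r s
        + lambda_2 a b d f z * kulkarni_nomizu (metric_tensor g) (ricci g) z p q r s"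
    if z: "z \<in> M" for z p q r s
  proof -
    define \<mu> where "\<mu> = - 2 * partial_deriv 1 f (xy_part z) / f (xy_part z)"
    define w' where "w' = partial_deriv 3 weyl_coefficient z"
    have "lie_derivative4 coord_vector_x (weyl g) z p q r s
      = partial_deriv 3 (\<lambda>v. weyl_coefficient v * block_weyl (rt_base a b d) (rt_fibre f) v p q r s) z"
      unfolding lie_derivative4_coord_vector_x
      by (rule partial_deriv_cong_open[OF open_M z]) (rule weyl_rt)
    also have "\<dots> = w' * block_weyl (rt_base a b d) (rt_fibre f) z p q r s
      + weyl_coefficient z * \<mu> * (kulkarni_nomizu (rt_fibre f) (rt_fibre f) z p q r s
          - (1/2) * kulkarni_nomizu (rt_base a b d) (rt_fibre f) z p q r s)"
      unfolding w'_def
      by (rule partial_deriv_block_weyl)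
         (use smooth_on_differentiable[OF _ z] smooth_on_weyl_coefficient smooth_on_rt_base smooth_on_rt_fibre
            partial_deriv_x_rt_base partial_deriv_x_rt_fibre[OF z] in \<open>auto simp: \<mu>_def\<close>)
    also have "\<dots> = lambda_C a d f z * (weyl_coefficient z * block_weyl (rt_base a b d) (rt_fibre f) z p q r s)
        + lambda_1 a b d f z * kulkarni_nomizu (metric_tensor g) (metric_tensor g) z p q r s
        + lambda_2 a b d f z * kulkarni_nomizu (metric_tensor g) (ricci g) z p q r s"
      unfolding w'_def \<mu>_def
      by (rule conformal_inheritance_two_block[where g = g and h = "rt_base a b d" and k = "rt_fibre f",
            OF metric_tensor_rt_metric ricci_rt[OF z] inheritance_coefficients[OF z nondeg1[OF z] nondeg2[OF z]]])
    also note weyl_rt[OF z, symmetric]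
    finally show ?thesis .
  qed
  ultimately show ?thesis
    unfolding generalized_weyl_conformal_inheritance_def by blast
qed

end
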